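(* Let $\mathcal{G}=(\mathcal{V},\mathcal{E})$ be a finite graph which is join-irreducible, and let $$R(\mathcal{G})=\{x\in[0,1]^{\mathcal{V}}:\ \mathfrak{K}_{\mathcal{G}'}(x|_{\mathcal{G}'})>0\text{ for every induced subgraph }\mathcal{G}'\subseteq\mathcal{G}\}.$$ Then at every point $x\in\partial R(\mathcal{G})\cap(0,\infty)^{\mathcal{V}}$ the partial derivatives $\partial_j\mathfrak{K}_{\mathcal{G}}(x)$, $j\in\mathcal{V}$, are nonzero, and hence $\partial R(\mathcal{G})\cap(0,\infty)^{\mathcal{V}}$ is a smooth submanifold of $(0,\infty)^{\mathcal{V}}$.
   Context: Graphs are finite, simple and undirected. A clique is a set of pairwise adjacent vertices (the empty set is a clique). An induced subgraph $\mathcal{G}'$ has vertex set $\mathcal{V}'\subseteq\mathcal{V}$ and all edges of $\mathcal{G}$ between vertices of $\mathcal{V}'$; $x|_{\mathcal{G}'}=(x_v)_{v\in\mathcal{V}'}$. $\mathfrak{K}_{\mathcal{G}}(x)=\sum_{\mathcal{K}\subseteq\mathcal{V}\text{ clique}}(-1)^{|\mathcal{K}|}\prod_{v\in\mathcal{K}}x_v$, the empty clique contributing $1$. The graph join $\mathcal{G}_1+\mathcal{G}_2$ of graphs with disjoint vertex sets has vertex set $\mathcal{V}_1\sqcup\mathcal{V}_2$, two vertices being adjacent iff they are adjacent in the same $\mathcal{G}_i$ or lie in different $\mathcal{G}_i$. A graph is join-irreducible if it cannot be written as the join of two nonempty graphs. *)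

theory Defs
  imports "HOL-Analysis.Analysis"
begin

text \<open>A finite simple graph is modelled on a finite vertex type 'a (vertex set = UNIV)
with a symmetric irreflexive adjacency relation E. Points of R^V are functions 'a => real,
carrying the product (= Euclidean) topology.\<close>

definition simple_graph :: "('a \<Rightarrow> 'a \<Rightarrow> bool) \<Rightarrow> bool" where
  "simple_graph E \<longleftrightarrow> (\<forall>u v. E u v \<longrightarrow> E v u) \<and> (\<forall>v. \<not> E v v)"

definition is_clique :: "('a \<Rightarrow> 'a \<Rightarrow> bool) \<Rightarrow> 'a set \<Rightarrow> bool" where
  "is_clique E K \<longleftrightarrow> (\<forall>u\<in>K. \<forall>v\<in>K. u \<noteq> v \<longrightarrow> E u v)"

text \<open>Clique polynomial of the induced subgraph on vertex set S, evaluated at x restricted to S.\<close>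
definition clique_poly :: "('a \<Rightarrow> 'a \<Rightarrow> bool) \<Rightarrow> 'a set \<Rightarrow> ('a \<Rightarrow> real) \<Rightarrow> real" where
  "clique_poly E S x = (\<Sum>K\<in>{K. K \<subseteq> S \<and> is_clique E K}. (-1) ^ card K * (\<Prod>v\<in>K. x v))"

text \<open>G (on vertex set UNIV) is a join of two nonempty graphs iff UNIV splits into two
nonempty disjoint parts with all cross pairs adjacent.\<close>
definition join_irreducible :: "('a \<Rightarrow> 'a \<Rightarrow> bool) \<Rightarrow> bool" where
  "join_irreducible E \<longleftrightarrow>
     \<not> (\<exists>A B. A \<noteq> {} \<and> B \<noteq> {} \<and> A \<inter> B = {} \<and> A \<union> B = UNIV \<and> (\<forall>a\<in>A. \<forall>b\<in>B. E a b))"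

definition R_set :: "('a \<Rightarrow> 'a \<Rightarrow> bool) \<Rightarrow> ('a \<Rightarrow> real) set" where
  "R_set E = {x. (\<forall>v. 0 \<le> x v \<and> x v \<le> 1) \<and> (\<forall>S. clique_poly E S x > 0)}"

end

theory Submission
  imports Defs
begin

text \<open>Deleting a vertex v with neighbourhood N(v) gives the recursion
K_{S+v} = K_S - x_v K_{S \<inter> N(v)}, so the partial derivative of K_G in x_j is -K_{N(j)}, and it
suffices to show K_S(x) > 0 for every proper S. On the closure of R(G) all K_S are nonnegative.
If K_S(x) = 0 for a proper S, join-irreducibility yields b \<notin> S with S \<inter> N(b) \<subset> S,
and then K_{S+b}(x) = -x_b K_{S \<inter> N(b)}(x) < 0 by induction on S, a contradiction.\<close>

lemma simple_graph_sym: "simple_graph E \<Longrightarrow> E u v \<Longrightarrow> E v u"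
  unfolding simple_graph_def by blast

lemma simple_graph_irrefl: "simple_graph E \<Longrightarrow> \<not> E v v"
  unfolding simple_graph_def by blast

lemma clique_poly_cong:
  assumes "\<And>v. v \<in> S \<Longrightarrow> y v = z v"
  shows "clique_poly E S y = clique_poly E S z"
  unfolding clique_poly_def using assms
  by (intro sum.cong refl) (metis (no_types, lifting) mem_Collect_eq prod.cong subsetD)

lemma clique_poly_empty: "clique_poly E {} x = 1"
proof -
  have "{K. K \<subseteq> {} \<and> is_clique E K} = {{}}" by (auto simp: is_clique_def)
  then show ?thesis unfolding clique_poly_def by simp
qed

lemma cliques_insert:
  assumes sg: "simple_graph E" and "v \<notin> S"
  shows "{K. K \<subseteq> insert v S \<and> is_clique E K} =
    {K. K \<subseteq> S \<and> is_clique E K} \<union> insert v ` {K. K \<subseteq> S \<inter> {u. E v u} \<and> is_clique E K}"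
    (is "?L = ?A \<union> ?B")
proof
  show "?L \<subseteq> ?A \<union> ?B"
  proof
    fix K assume K: "K \<in> ?L"
    show "K \<in> ?A \<union> ?B"
    proof (cases "v \<in> K")
      case True
      then have "K = insert v (K - {v})" by auto
      moreover have "K - {v} \<in> {K. K \<subseteq> S \<inter> {u. E v u} \<and> is_clique E K}"
        using K True unfolding is_clique_def by auto
      ultimately show ?thesis by blast
    qed (use K assms(2) in auto)
  qed
  show "?A \<union> ?B \<subseteq> ?L"
  proof
    fix K assume "K \<in> ?A \<union> ?B"
    then show "K \<in> ?L"
    proof
      assume "K \<in> ?B"
      then obtain L where "K = insert v L" "L \<subseteq> S \<inter> {u. E v u}" "is_clique E L"
        by auto
      moreover have "E u v" if "u \<in> L" for u
        using that \<open>L \<subseteq> S \<inter> {u. E v u}\<close> simple_graph_sym[OF sg] by blast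
      ultimately show ?thesis
        unfolding is_clique_def by auto
    qed auto
  qed
qed

lemma clique_poly_insert:
  fixes E :: "'a::finite \<Rightarrow> 'a \<Rightarrow> bool"
  assumes sg: "simple_graph E" and "v \<notin> S"
  shows "clique_poly E (insert v S) x = clique_poly E S x - x v * clique_poly E (S \<inter> {u. E v u}) x"
proof -
  let ?f = "\<lambda>K. (-1::real) ^ card K * (\<Prod>u\<in>K. x u)"
  define C where "C = {K. K \<subseteq> S \<inter> {u. E v u} \<and> is_clique E K}"
  have v_notin: "v \<notin> K" if "K \<in> C" for K
    using that simple_graph_irrefl[OF sg] by (auto simp: C_def)
  have "inj_on (insert v) C"
    by (rule inj_onI) (metis insert_ident v_notin)
  then have "sum ?f (insert v ` C) = sum (?f \<circ> insert v) C"
    by (rule sum.reindex)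
  also have "\<dots> = sum (\<lambda>K. - x v * ?f K) C"
    using v_notin by (intro sum.cong) auto
  also have "\<dots> = - x v * clique_poly E (S \<inter> {u. E v u}) x"
    by (simp add: clique_poly_def C_def sum_distrib_left)
  finally have "sum ?f (insert v ` C) = - x v * clique_poly E (S \<inter> {u. E v u}) x" .
  moreover have "{K. K \<subseteq> S \<and> is_clique E K} \<inter> insert v ` C = {}"
    using assms(2) by auto
  ultimately show ?thesis
    unfolding clique_poly_def cliques_insert[OF assms] C_def[symmetric]
    by (subst sum.union_disjoint) auto
qed

lemma clique_poly_fun_upd:
  fixes E :: "'a::finite \<Rightarrow> 'a \<Rightarrow> bool"
  assumes sg: "simple_graph E" and "j \<in> S"
  shows "clique_poly E S (x(j := t)) =
    clique_poly E (S - {j}) x - t * clique_poly E (S \<inter> {u. E j u}) x"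
proof -
  have nbhd: "S \<inter> {u. E j u} = (S - {j}) \<inter> {u. E j u}"
    using simple_graph_irrefl[OF sg] by auto
  have "S = insert j (S - {j})"
    using assms(2) by auto
  then have "clique_poly E S (x(j := t)) =
      clique_poly E (S - {j}) (x(j := t)) - t * clique_poly E (S \<inter> {u. E j u}) (x(j := t))"
    using clique_poly_insert[OF sg, of j "S - {j}" "x(j := t)"] nbhd by simp
  also have "clique_poly E (S - {j}) (x(j := t)) = clique_poly E (S - {j}) x"
    by (rule clique_poly_cong) simp
  also have "clique_poly E (S \<inter> {u. E j u}) (x(j := t)) = clique_poly E (S \<inter> {u. E j u}) x"
    using simple_graph_irrefl[OF sg] by (intro clique_poly_cong) auto
  finally show ?thesis .
qed

lemma deriv_clique_poly_fun_upd:
  fixes E :: "'a::finite \<Rightarrow> 'a \<Rightarrow> bool"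
  assumes "simple_graph E" and "j \<in> S"
  shows "deriv (\<lambda>t. clique_poly E S (x(j := t))) s = - clique_poly E (S \<inter> {u. E j u}) x"
proof -
  let ?a = "clique_poly E (S - {j}) x" and ?b = "clique_poly E (S \<inter> {u. E j u}) x"
  have "((\<lambda>t. ?a - t * ?b) has_real_derivative 0 - 1 * ?b) (at s)"
    by (intro derivative_intros DERIV_cmult_right DERIV_ident)
  then show ?thesis
    unfolding clique_poly_fun_upd[OF assms] by (simp add: DERIV_imp_deriv)
qed

lemma continuous_on_clique_poly: "continuous_on UNIV (clique_poly E S)"
  unfolding clique_poly_def[abs_def]
  by (intro continuous_intros continuous_on_product_coordinates)

lemma clique_poly_nonneg_closure_R_set:
  assumes "x \<in> closure (R_set E)"
  shows "clique_poly E S x \<ge> 0"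
proof -
  have "closed {x. clique_poly E S x \<ge> 0}"
    using continuous_on_clique_poly by (intro closed_Collect_le continuous_intros) auto
  moreover have "R_set E \<subseteq> {x. clique_poly E S x \<ge> 0}"
    unfolding R_set_def by (auto intro: less_imp_le)
  ultimately have "closure (R_set E) \<subseteq> {x. clique_poly E S x \<ge> 0}"
    by (intro closure_minimal)
  then show ?thesis using assms by auto
qed

lemma clique_poly_pos_proper:
  fixes E :: "'a::finite \<Rightarrow> 'a \<Rightarrow> bool"
  assumes sg: "simple_graph E" and ji: "join_irreducible E"
    and nonneg: "\<And>S. clique_poly E S x \<ge> 0" and pos: "\<And>v. x v > 0"
    and "S \<noteq> UNIV"
  shows "clique_poly E S x > 0"
  using finite[of S] \<open>S \<noteq> UNIV\<close>
proof (induction S rule: finite_psubset_induct)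
  case (psubset S)
  show ?case
  proof (rule ccontr)
    assume "\<not> clique_poly E S x > 0"
    then have zero: "clique_poly E S x = 0" using nonneg[of S] by simp
    then have "S \<noteq> {}" using clique_poly_empty[of E x] by auto
    moreover have "- S \<noteq> {}" using psubset.prems by auto
    ultimately have "\<not> (\<forall>a\<in>S. \<forall>b\<in>- S. E a b)"
      using ji unfolding join_irreducible_def
      by (metis Compl_partition Compl_disjoint)
    then obtain a b where "a \<in> S" "b \<notin> S" "\<not> E a b" by auto
    then have "S \<inter> {u. E b u} \<subset> S"
      using simple_graph_sym[OF sg] by blast
    then have "clique_poly E (S \<inter> {u. E b u}) x > 0"
      using psubset.IH by blast
    then have "clique_poly E (insert b S) x < 0"
      using clique_poly_insert[OF sg \<open>b \<notin> S\<close>] zero pos[of b] by simp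
    then show False using nonneg[of "insert b S"] by simp
  qed
qed

theorem proposition4p6:
  fixes E :: "'a::finite \<Rightarrow> 'a \<Rightarrow> bool" and x :: "'a \<Rightarrow> real"
  assumes "simple_graph E"
    and "join_irreducible E"
    and "x \<in> frontier (R_set E)"
    and "\<forall>v. x v > 0"
  shows "\<forall>j. deriv (\<lambda>t. clique_poly E UNIV (x(j := t))) (x j) \<noteq> 0"
proof
  fix j
  have "x \<in> closure (R_set E)"
    using assms(3) by (simp add: frontier_def)
  then have nonneg: "\<And>S. clique_poly E S x \<ge> 0"
    by (rule clique_poly_nonneg_closure_R_set)
  have "clique_poly E {u. E j u} x > 0"
    using assms(4) simple_graph_irrefl[OF assms(1)]
    by (intro clique_poly_pos_proper[OF assms(1,2) nonneg]) auto
  then show "deriv (\<lambda>t. clique_poly E UNIV (x(j := t))) (x j) \<noteq> 0"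
    using deriv_clique_poly_fun_upd[OF assms(1), of j UNIV x "x j"] by simp
qed

end
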